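(* Let $\overline{z}=\big((\overline{c}_t^h),(\overline{a}_t^h)\big)\in\mathcal{U}$. Then $\overline{z}$ is Pareto optimal for $\min_{z\in\mathcal{U}}\varphi(z)$ if and only if there exist multipliers $\theta=(\theta_1,\dots,\theta_H)\in\mathbb{R}^H$ with at least one $\theta_h\ne 0$, $\lambda=(\lambda_t^h)_{t=0,\dots,T;\,h=1,\dots,H}\in\mathbb{R}^{H(T+1)}$ and $\nu=(\nu_1,\dots,\nu_{T+1})\in\mathbb{R}^{T+1}$ such that (I) $-\theta_h(\beta^h)^t(u^h)'(\overline{c}_t^h)+\tau\lambda_t^h=0$ for $t=0,\dots,T$, $h=1,\dots,H$; (II) $-\nu_t+\lambda_{t-1}^h-\lambda_t^h(\tau(1+r_t)-\delta)=0$ for $t=1,\dots,T$, $h=1,\dots,H$; (III) $\lambda_T^h-\nu_{T+1}=0$ for $h=1,\dots,H$; (IV) $-\sum_{h=1}^H\nu_t\overline{a}_t^h=0$ for $t=1,\dots,T+1$; (V) $\theta_h\ge 0$ and $\nu_t\ge 0$ for $h=1,\dots,H$, $t=1,\dots,T+1$.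
   Context: Data: positive integers $H,T$; real constants $r_t>0$, $\omega_t\ge 1$ ($t=0,\dots,T$), $l^h>0$, $\beta^h\in(0,1)$ ($h=1,\dots,H$), $\tau\ge 1$, $\delta\in(0,1)$; given initial values $a_0^1,\dots,a_0^H\in\mathbb{R}$ with $\sum_{h=1}^H a_0^h>0$. Utility functions $u^h:(0,\infty)\to\mathbb{R}$ ($h=1,\dots,H$) are twice continuously differentiable with $(u^h)'(c)>0$, $(u^h)''(c)<0$ for all $c>0$, $\lim_{c\to\infty}(u^h)'(c)=0$ and $\lim_{c\to 0}(u^h)'(c)=+\infty$ (Inada condition). Variables: $z=\big((c_t^h)_{t=0,\dots,T;\,h=1,\dots,H},(a_t^h)_{t=1,\dots,T+1;\,h=1,\dots,H}\big)\in\mathbb{R}^{2H(T+1)}$. The feasible set $\mathcal{U}$ consists of all $z$ with $c_t^h>0$ for all $t=0,\dots,T$, $h=1,\dots,H$, satisfying $$a_{t+1}^h=\tau\omega_t l^h+(\tau(1+r_t)-\delta)a_t^h-\tau c_t^h\quad(t=0,\dots,T,\ h=1,\dots,H),$$ $$\sum_{h=1}^H a_t^h\ge 0\quad (t=1,\dots,T+1).$$ The objective $\varphi=(\varphi_1,\dots,\varphi_H)$ is $\varphi_h(z)=-\sum_{t=0}^T(\beta^h)^t u^h(c_t^h)$, where $(\beta^h)^t$ is the $t$-th power of $\beta^h$. A point $\overline{z}\in\mathcal{U}$ is Pareto optimal if there is no $z\in\mathcal{U}$ with $\varphi_h(z)\le\varphi_h(\overline{z})$ for all $h$ and $\varphi_{h^*}(z)<\varphi_{h^*}(\overline{z})$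 for at least one $h^*$. *)

theory Defs
  imports "HOL-Analysis.Analysis"
begin

text \<open>
  A decision variable is a pair \<open>(c, a)\<close>, where \<open>c t h\<close> is the consumption of household \<open>h\<close> in
  period \<open>t\<close> and \<open>a t h\<close> its assets.  Only the entries \<open>c t h\<close> with \<open>t \<le> T\<close> and \<open>a t h\<close> with
  \<open>1 \<le> t \<le> T + 1\<close>, for \<open>1 \<le> h \<le> H\<close>, are coordinates of the problem; nothing below depends on
  the other values.  In particular \<open>a 0\<close> is never read: the initial assets are the datum \<open>a0\<close>.
\<close>

type_synonym plan = "(nat \<Rightarrow> nat \<Rightarrow> real) \<times> (nat \<Rightarrow> nat \<Rightarrow> real)"

definition assets :: "(nat \<Rightarrow> real) \<Rightarrow> (nat \<Rightarrow> nat \<Rightarrow> real) \<Rightarrow> nat \<Rightarrow> nat \<Rightarrow> real" where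
  "assets a0 a t h = (if t = 0 then a0 h else a t h)"

definition feasible_set ::
    "nat \<Rightarrow> nat \<Rightarrow> (nat \<Rightarrow> real) \<Rightarrow> (nat \<Rightarrow> real) \<Rightarrow> (nat \<Rightarrow> real) \<Rightarrow> real \<Rightarrow> real \<Rightarrow>
     (nat \<Rightarrow> real) \<Rightarrow> plan set" where
  "feasible_set H T r \<omega> l \<tau> \<delta> a0 =
    {(c, a).
      (\<forall>t\<in>{0..T}. \<forall>h\<in>{1..H}. c t h > 0) \<and>
      (\<forall>t\<in>{0..T}. \<forall>h\<in>{1..H}.
         assets a0 a (t + 1) h =
           \<tau> * \<omega> t * l h + (\<tau> * (1 + r t) - \<delta>) * assets a0 a t h - \<tau> * c t h) \<and>
      (\<forall>t\<in>{1..T + 1}. (\<Sum>h=1..H. a t h) \<ge> 0)}"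

definition objective ::
    "nat \<Rightarrow> (nat \<Rightarrow> real) \<Rightarrow> (nat \<Rightarrow> real \<Rightarrow> real) \<Rightarrow> nat \<Rightarrow> plan \<Rightarrow> real" where
  "objective T \<beta> u h z = - (\<Sum>t=0..T. \<beta> h ^ t * u h (fst z t h))"

definition pareto_optimal ::
    "nat \<Rightarrow> 'z set \<Rightarrow> (nat \<Rightarrow> 'z \<Rightarrow> real) \<Rightarrow> 'z \<Rightarrow> bool" where
  "pareto_optimal H U \<phi> zbar \<longleftrightarrow>
    zbar \<in> U \<and>
    \<not> (\<exists>z\<in>U. (\<forall>h\<in>{1..H}. \<phi> h z \<le> \<phi> h zbar) \<and> (\<exists>h\<in>{1..H}. \<phi> h z < \<phi> h zbar))"

text \<open>
  Utility functions live on \<open>(0, \<infinity>)\<close>; they are represented by total functions whose values on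
  \<open>(-\<infinity>, 0]\<close> are unconstrained.
\<close>

definition inada_utility :: "(real \<Rightarrow> real) \<Rightarrow> bool" where
  "inada_utility v \<longleftrightarrow>
    v differentiable_on {0<..} \<and>
    deriv v differentiable_on {0<..} \<and>
    continuous_on {0<..} (deriv (deriv v)) \<and>
    (\<forall>c>0. deriv v c > 0) \<and>
    (\<forall>c>0. deriv (deriv v) c < 0) \<and>
    (deriv v \<longlongrightarrow> 0) at_top \<and>
    filterlim (deriv v) at_top (at_right 0)"

end

theory Submission
  imports Defs
begin

text \<open>
  The constraints tie the households together only through the aggregate assets, and these only
  see aggregate consumption.  For sufficiency, (II) and (III) force \<open>\<lambda>\<close> to be independent of the
  household, hence all \<open>\<theta>\<close> are positive, and the concave problem is solved by summation by parts.
  For necessity no separation theorem is needed: a Pareto improving direction arises if two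
  households differ in their marginal rates of substitution between periods \<open>t\<close> and \<open>T\<close> (they
  trade), if one household gains by saving, or if it gains by dissaving while aggregate assets
  are positive.  Hence the normalised marginal utilities \<open>p t h / p T h\<close> serve as \<open>\<lambda>\<close>.
\<close>

section \<open>Derivatives and concavity of utility functions\<close>

lemma inada_utility_DERIV:
  assumes "inada_utility v" "x > 0"
  shows "(v has_real_derivative deriv v x) (at x)"
    and "(deriv v has_real_derivative deriv (deriv v) x) (at x)"
proof -
  have "v differentiable_on {0<..}" "deriv v differentiable_on {0<..}"
    using assms(1) by (auto simp: inada_utility_def)
  then have "v differentiable at x" "deriv v differentiable at x"
    using assms(2) by (auto simp: differentiable_on_eq_differentiable_at)
  then show "(v has_real_derivative deriv v x) (at x)"
    and "(deriv v has_real_derivative deriv (deriv v) x) (at x)"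
    by (metis DERIV_imp_deriv real_differentiable_def)+
qed

text \<open>The negative second derivative makes \<open>- v\<close> convex on the positive
  half-line, so \<open>- v\<close> lies above its tangents.\<close>

lemma inada_utility_le_tangent:
  assumes v: "inada_utility v" and "x > 0" "y > 0"
  shows "v y \<le> v x + deriv v x * (y - x)"
proof -
  have "- deriv v x * (y - x) \<le> - v y - - v x"
  proof (rule f''_imp_f'[where C = "{0<..}" and f'' = "\<lambda>x. - deriv (deriv v) x"])
    show "((\<lambda>x. - v x) has_real_derivative - deriv v x) (at x)" if "x \<in> {0<..}" for x
      using inada_utility_DERIV(1)[OF v] that by (auto intro!: DERIV_minus)
    show "((\<lambda>x. - deriv v x) has_real_derivative - deriv (deriv v) x) (at x)"
      if "x \<in> {0<..}" for x
      using inada_utility_DERIV(2)[OF v] that by (auto intro!: DERIV_minus)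
    show "- deriv (deriv v) x \<ge> 0" if "x \<in> {0<..}" for x
      using v that by (auto simp: inada_utility_def less_imp_le)
  qed (use assms in auto)
  then show ?thesis by (simp add: algebra_simps)
qed

lemma eventually_affine_pos:
  fixes x d :: real
  assumes "x > 0"
  shows "\<forall>\<^sub>F e in at_right 0. x + e * d > 0"
proof -
  have "((\<lambda>e. x + e * d) \<longlongrightarrow> x + 0 * d) (at_right 0)"
    by (intro tendsto_intros)
  then show ?thesis
    using assms by (auto dest: order_tendstoD(1)[where a = 0])
qed

section \<open>The economy with a fixed feasible candidate, and its aggregate budget\<close>

locale economy =
  fixes H T :: nat
    and r \<omega> l \<beta> a0 :: "nat \<Rightarrow> real"
    and \<tau> \<delta> :: real
    and u :: "nat \<Rightarrow> real \<Rightarrow> real"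
    and c a :: "nat \<Rightarrow> nat \<Rightarrow> real"
  assumes H_pos: "H > 0"
    and \<beta>_pos: "h \<in> {1..H} \<Longrightarrow> \<beta> h > 0"
    and \<tau>_pos: "\<tau> > 0"
    and utility: "h \<in> {1..H} \<Longrightarrow> inada_utility (u h)"
    and feasible: "(c, a) \<in> feasible_set H T r \<omega> l \<tau> \<delta> a0"
begin

abbreviation "U \<equiv> feasible_set H T r \<omega> l \<tau> \<delta> a0"

definition q :: "nat \<Rightarrow> real" where "q t = \<tau> * (1 + r t) - \<delta>"

text \<open>Discounted marginal utility: minus the partial derivative of the objective of
  \<open>h\<close> in the coordinate \<open>c t h\<close>.\<close>

definition p :: "nat \<Rightarrow> nat \<Rightarrow> real" where "p t h = \<beta> h ^ t * deriv (u h) (c t h)"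

lemma c_pos: "t \<le> T \<Longrightarrow> h \<in> {1..H} \<Longrightarrow> c t h > 0"
  using feasible by (auto simp: feasible_set_def)

lemma p_pos: "t \<le> T \<Longrightarrow> h \<in> {1..H} \<Longrightarrow> p t h > 0"
  using c_pos[of t h] \<beta>_pos[of h] utility[of h] by (auto simp: p_def inada_utility_def)

text \<open>The factor \<open>q t\<close> is common to all households, so the individual budget
  equations add up to one recursion in aggregates.\<close>

lemma aggregate_assets:
  assumes "(c', a') \<in> U" "t \<le> T"
  shows "(\<Sum>h=1..H. assets a0 a' (Suc t) h) =
    \<tau> * \<omega> t * (\<Sum>h=1..H. l h) + q t * (\<Sum>h=1..H. assets a0 a' t h) - \<tau> * (\<Sum>h=1..H. c' t h)"
proof -
  have "(\<Sum>h=1..H. assets a0 a' (Suc t) h) =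
      (\<Sum>h=1..H. \<tau> * \<omega> t * l h + q t * assets a0 a' t h - \<tau> * c' t h)"
    using assms by (intro sum.cong) (auto simp: feasible_set_def q_def)
  then show ?thesis
    by (simp add: sum.distrib sum_subtractf sum_distrib_left)
qed

section \<open>First-order Pareto improvements\<close>

text \<open>Consumption moves along \<open>d\<close>, and \<open>B\<close> is the resulting change
  of aggregate assets per unit step. A short step stays feasible, since assets fall only where there
  is slack, and each household is either unaffected or gains at first order.\<close>

lemma improving_direction_not_pareto:
  fixes d :: "nat \<Rightarrow> nat \<Rightarrow> real" and B :: "nat \<Rightarrow> real"
  assumes B0: "B 0 = 0"
    and B_Suc: "\<And>t. t \<le> T \<Longrightarrow> B (Suc t) = q t * B t - \<tau> * (\<Sum>h=1..H. d t h)"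
    and B_feas: "\<And>t. t \<in> {1..T + 1} \<Longrightarrow> B t \<ge> 0 \<or> (\<Sum>h=1..H. a t h) > 0"
    and gain: "\<And>h. h \<in> {1..H} \<Longrightarrow> (\<forall>t\<le>T. d t h = 0) \<or> (\<Sum>t=0..T. p t h * d t h) > 0"
    and k: "k \<in> {1..H}" "(\<Sum>t=0..T. p t k * d t k) > 0"
  shows "\<not> pareto_optimal H U (objective T \<beta> u) (c, a)"
proof -
  \<comment> \<open>The response of individual assets to \<open>d\<close>: the budget recursion
    without its constant term, started at 0 because initial assets are data.\<close>
  define b where "b = rec_nat (\<lambda>_. 0) (\<lambda>t bt h. q t * bt h - \<tau> * d t h)"
  have b_0: "b 0 h = 0" and b_Suc: "b (Suc t) h = q t * b t h - \<tau> * d t h" for t h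
    by (simp_all add: b_def)
  have b_sum: "(\<Sum>h=1..H. b t h) = B t" if "t \<le> T + 1" for t
    using that
  proof (induction t)
    case (Suc t)
    then show ?case
      by (simp add: b_Suc B_Suc sum_subtractf flip: sum_distrib_left)
  qed (simp add: b_0 B0)
  define z where "z e = ((\<lambda>t h. c t h + e * d t h), (\<lambda>t h. a t h + e * b t h))" for e :: real
  have ev_pos: "\<forall>\<^sub>F e in at_right 0. \<forall>t\<in>{0..T}. \<forall>h\<in>{1..H}. c t h + e * d t h > 0"
    by (intro eventually_ball_finite ballI finite_atLeastAtMost eventually_affine_pos)
      (use c_pos in auto)
  have ev_assets: "\<forall>\<^sub>F e in at_right 0. \<forall>t\<in>{1..T + 1}. (\<Sum>h=1..H. a t h + e * b t h) \<ge> 0"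
  proof (intro eventually_ball_finite ballI finite_atLeastAtMost)
    fix t assume t: "t \<in> {1..T + 1}"
    have eq: "(\<Sum>h=1..H. a t h + e * b t h) = (\<Sum>h=1..H. a t h) + e * B t" for e
      using b_sum[of t] t by (simp add: sum.distrib flip: sum_distrib_left)
    have nonneg: "(\<Sum>h=1..H. a t h) \<ge> 0"
      using feasible t by (auto simp: feasible_set_def)
    show "\<forall>\<^sub>F e in at_right 0. (\<Sum>h=1..H. a t h + e * b t h) \<ge> 0"
    proof (cases "B t \<ge> 0")
      case True
      show ?thesis
        unfolding eq using eventually_at_right_less[of 0]
        by eventually_elim (use nonneg True in auto)
    next
      case False
      then have "(\<Sum>h=1..H. a t h) > 0" using B_feas[OF t] by auto
      from eventually_affine_pos[OF this, of "B t"] show ?thesis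
        unfolding eq by eventually_elim auto
    qed
  qed
  have gain_less: "\<forall>\<^sub>F e in at_right 0. objective T \<beta> u h (z e) < objective T \<beta> u h (c, a)"
    if h: "h \<in> {1..H}" and pos: "(\<Sum>t=0..T. p t h * d t h) > 0" for h
  proof -
    \<comment> \<open>Utility of \<open>h\<close> along the ray; its derivative at 0 is the sum
      assumed positive, so it increases just to the right of 0.\<close>
    let ?g = "\<lambda>e. \<Sum>t=0..T. \<beta> h ^ t * u h (c t h + e * d t h)"
    have "(?g has_real_derivative (\<Sum>t=0..T. \<beta> h ^ t * (deriv (u h) (c t h) * d t h))) (at 0)"
    proof (intro DERIV_sum DERIV_cmult)
      fix t assume "t \<in> {0..T}"
      then have "(u h has_real_derivative deriv (u h) (c t h)) (at (c t h + 0 * d t h))"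
        using inada_utility_DERIV(1)[OF utility[OF h]] c_pos[OF _ h] by auto
      moreover have "((\<lambda>e. c t h + e * d t h) has_real_derivative d t h) (at 0)"
        by (auto intro!: derivative_eq_intros)
      ultimately show "((\<lambda>e. u h (c t h + e * d t h)) has_real_derivative
          deriv (u h) (c t h) * d t h) (at 0)"
        by (rule DERIV_chain2)
    qed
    moreover have "(\<Sum>t=0..T. \<beta> h ^ t * (deriv (u h) (c t h) * d t h)) > 0"
      using pos by (simp add: p_def mult.assoc)
    ultimately obtain \<eta> where "\<eta> > 0" "\<forall>e>0. e < \<eta> \<longrightarrow> ?g 0 < ?g (0 + e)"
      using DERIV_pos_inc_right by blast
    then show ?thesis
      by (auto simp: eventually_at_right_field objective_def z_def)
  qed
  have ev_le: "\<forall>\<^sub>F e in at_right 0. \<forall>h\<in>{1..H}. objective T \<beta> u h (z e) \<le> objective T \<beta> u h (c, a)"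
  proof (intro eventually_ball_finite ballI finite_atLeastAtMost)
    fix h assume h: "h \<in> {1..H}"
    show "\<forall>\<^sub>F e in at_right 0. objective T \<beta> u h (z e) \<le> objective T \<beta> u h (c, a)"
    proof (cases "\<forall>t\<le>T. d t h = 0")
      case True
      then show ?thesis by (simp add: objective_def z_def)
    next
      case False
      with gain[OF h] gain_less[OF h] show ?thesis
        by (auto elim: eventually_mono)
    qed
  qed
  have "\<forall>\<^sub>F e in at_right 0. z e \<in> U \<and> (\<forall>h\<in>{1..H}. objective T \<beta> u h (z e) \<le> objective T \<beta> u h (c, a))
      \<and> objective T \<beta> u k (z e) < objective T \<beta> u k (c, a)"
    using ev_pos ev_assets ev_le gain_less[OF k]
  proof eventually_elim
    case (elim e)
    have "assets a0 (snd (z e)) (t + 1) h = \<tau> * \<omega> t * l h + (\<tau> * (1 + r t) - \<delta>) *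
        assets a0 (snd (z e)) t h - \<tau> * fst (z e) t h" if "t \<le> T" "h \<in> {1..H}" for t h
    proof -
      \<comment> \<open>This includes \<open>s = 0\<close>, where \<open>assets\<close> reads
        \<open>a0\<close> and \<open>b 0 h\<close> vanishes.\<close>
      have shift: "assets a0 (snd (z e)) s h = assets a0 a s h + e * b s h" for s
        by (simp add: assets_def z_def b_0)
      have "assets a0 a (t + 1) h = \<tau> * \<omega> t * l h + q t * assets a0 a t h - \<tau> * c t h"
        using feasible that by (auto simp: feasible_set_def q_def)
      then show ?thesis
        unfolding shift by (simp add: b_Suc z_def flip: q_def) (simp add: algebra_simps)
    qed
    with elim show ?case
      by (auto simp: feasible_set_def z_def)
  qed
  then obtain e where "z e \<in> U" "\<forall>h\<in>{1..H}. objective T \<beta> u h (z e) \<le> objective T \<beta> u h (c, a)"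
      "objective T \<beta> u k (z e) < objective T \<beta> u k (c, a)"
    using eventually_happens trivial_limit_at_right_real by blast
  then show ?thesis
    using k(1) unfolding pareto_optimal_def by blast
qed

section \<open>Trades and savings excluded by Pareto optimality\<close>

context
  assumes pareto: "pareto_optimal H U (objective T \<beta> u) (c, a)"
begin

text \<open>Otherwise \<open>k\<close> could buy a unit of period \<open>t\<close> consumption from
  \<open>h\<close>, paying in period \<open>T\<close> at a price \<open>g\<close> strictly between
  their marginal rates, and both would gain. Exchanging \<open>h\<close> and \<open>k\<close> gives
  equality.\<close>

lemma marginal_rates_le:
  assumes h: "h \<in> {1..H}" and k: "k \<in> {1..H}" and t: "t \<le> T"
  shows "p t k / p T k \<le> p t h / p T h"
proof (rule ccontr)
  assume "\<not> ?thesis"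
  then obtain g where g: "p t h / p T h < g" "g < p t k / p T k"
    using dense by (metis not_le)
  \<comment> \<open>At \<open>t = T\<close> both ratios would be 1, leaving no room for
    \<open>g\<close>.\<close>
  then have ne: "h \<noteq> k" "t \<noteq> T" using p_pos[OF le_refl h] p_pos[OF le_refl k] by auto
  \<comment> \<open>What the buyer \<open>k\<close> receives; \<open>h\<close> gets the negative, so
    aggregate consumption, and with it aggregate assets, stay unchanged.\<close>
  define x where "x = (\<lambda>s. if s = t then 1 else if s = T then - g else 0)"
  define d where "d = (\<lambda>s i. (if i = k then x s else 0) - (if i = h then x s else 0))"
  have px: "(\<Sum>s=0..T. p s i * x s) = p t i - g * p T i" for i
  proof -
    have "p s i * x s = (if s = t then p t i else 0) + (if s = T then - g * p T i else 0)" for s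
      using ne by (auto simp: x_def)
    then show ?thesis using t by (simp add: sum.distrib)
  qed
  have gain_k: "(\<Sum>s=0..T. p s k * d s k) > 0"
    using g(2) ne p_pos[OF le_refl k] by (simp add: d_def px pos_less_divide_eq)
  have "(\<Sum>s=0..T. p s h * d s h) = - (p t h - g * p T h)"
    using ne by (simp add: d_def sum_negf px)
  then have gain_h: "(\<Sum>s=0..T. p s h * d s h) > 0"
    using g(1) p_pos[OF le_refl h] by (simp add: pos_divide_less_eq)
  have "\<not> pareto_optimal H U (objective T \<beta> u) (c, a)"
  proof (rule improving_direction_not_pareto[where B = "\<lambda>_. 0" and d = d and k = k])
    show "0 = q s * 0 - \<tau> * (\<Sum>i=1..H. d s i)" for s
      using h k by (simp add: d_def sum_subtractf)
    show "(\<forall>s\<le>T. d s i = 0) \<or> (\<Sum>s=0..T. p s i * d s i) > 0" for i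
      using gain_h gain_k by (cases "i = h \<or> i = k") (auto simp: d_def)
  qed (use k gain_k in auto)
  with pareto show False by contradiction
qed

text \<open>
  Positive \<open>m\<close> is saving in period \<open>t\<close>, negative \<open>m\<close> is dissaving.
\<close>

lemma no_gain_from_saving:
  assumes h: "h \<in> {1..H}" and t: "Suc t \<le> T" and m: "m \<ge> 0 \<or> (\<Sum>i=1..H. a (Suc t) i) > 0"
  shows "m * (q (Suc t) * p (Suc t) h - p t h) \<le> 0"
proof (rule ccontr)
  assume gain: "\<not> ?thesis"
  \<comment> \<open>Giving up \<open>m\<close> units in period \<open>t\<close> adds
    \<open>\<tau> * m\<close> to assets at \<open>Suc t\<close>; consuming
    \<open>m * q (Suc t)\<close> more there returns assets to the old path. So only
    \<open>B (Suc t)\<close> can be nonzero.\<close>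
  define x where "x = (\<lambda>s. if s = t then - m else if s = Suc t then m * q (Suc t) else 0)"
  define d where "d = (\<lambda>s i. if i = h then x s else 0)"
  have "p s h * x s =
      (if s = t then - m * p t h else 0) + (if s = Suc t then m * q (Suc t) * p (Suc t) h else 0)" for s
    by (auto simp: x_def)
  then have "(\<Sum>s=0..T. p s h * d s h) = m * (q (Suc t) * p (Suc t) h - p t h)"
    using t by (simp add: d_def sum.distrib algebra_simps)
  with gain have pos: "(\<Sum>s=0..T. p s h * d s h) > 0" by simp
  have "\<not> pareto_optimal H U (objective T \<beta> u) (c, a)"
  proof (rule improving_direction_not_pareto[where B = "\<lambda>s. if s = Suc t then \<tau> * m else 0"
        and d = d and k = h])
    show "(if Suc s = Suc t then \<tau> * m else 0) =
        q s * (if s = Suc t then \<tau> * m else 0) - \<tau> * (\<Sum>i=1..H. d s i)" for s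
      using h by (simp add: d_def x_def)
    show "(if s = Suc t then \<tau> * m else 0) \<ge> 0 \<or> (\<Sum>i=1..H. a s i) > 0" for s
      using m \<tau>_pos by auto
    show "(\<forall>s\<le>T. d s i = 0) \<or> (\<Sum>s=0..T. p s i * d s i) > 0" for i
      using pos by (cases "i = h") (auto simp: d_def)
  qed (use h pos in auto)
  with pareto show False by contradiction
qed

text \<open>Any household could consume a little of a positive final surplus in period
  \<open>T\<close>.\<close>

lemma final_assets_eq_0: "(\<Sum>i=1..H. a (Suc T) i) = 0"
proof (rule ccontr)
  assume "(\<Sum>i=1..H. a (Suc T) i) \<noteq> 0"
  moreover have "(\<Sum>i=1..H. a (Suc T) i) \<ge> 0"
    using feasible by (auto simp: feasible_set_def)
  ultimately have pos: "(\<Sum>i=1..H. a (Suc T) i) > 0" by simp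
  obtain h where h: "h \<in> {1..H}" using H_pos by fastforce
  define d where "d = (\<lambda>s i. if i = h then if s = T then 1 else 0 else 0 :: real)"
  have "p s h * d s h = (if s = T then p T h else 0)" for s
    by (simp add: d_def)
  then have gain: "(\<Sum>s=0..T. p s h * d s h) > 0"
    using p_pos[OF le_refl h] by simp
  \<comment> \<open>The recursion for \<open>B\<close> is required only up to \<open>s = T\<close>,
    so the drop at \<open>Suc T\<close> never has to be made up.\<close>
  have "\<not> pareto_optimal H U (objective T \<beta> u) (c, a)"
  proof (rule improving_direction_not_pareto[where B = "\<lambda>s. if s = Suc T then - \<tau> else 0"
        and d = d and k = h])
    show "(if Suc s = Suc T then - \<tau> else 0) =
        q s * (if s = Suc T then - \<tau> else 0) - \<tau> * (\<Sum>i=1..H. d s i)" if "s \<le> T" for s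
      using h that by (simp add: d_def)
    show "(\<forall>s\<le>T. d s i = 0) \<or> (\<Sum>s=0..T. p s i * d s i) > 0" for i
      using gain by (cases "i = h") (auto simp: d_def)
  qed (use pos h gain in auto)
  with pareto show False by contradiction
qed

end

section \<open>Multipliers from marginal utilities\<close>

text \<open>Nontriviality, then (I) to (V) in the literal form of the theorem, for the fixed
  candidate \<open>(c, a)\<close>.\<close>

definition kkt :: "(nat \<Rightarrow> real) \<Rightarrow> (nat \<Rightarrow> nat \<Rightarrow> real) \<Rightarrow> (nat \<Rightarrow> real) \<Rightarrow> bool" where
  "kkt \<theta> lam \<nu> \<longleftrightarrow>
    (\<exists>h\<in>{1..H}. \<theta> h \<noteq> 0) \<and>
    (\<forall>t\<in>{0..T}. \<forall>h\<in>{1..H}. - \<theta> h * \<beta> h ^ t * deriv (u h) (c t h) + \<tau> * lam t h = 0) \<and>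
    (\<forall>t\<in>{1..T}. \<forall>h\<in>{1..H}. - \<nu> t + lam (t - 1) h - lam t h * (\<tau> * (1 + r t) - \<delta>) = 0) \<and>
    (\<forall>h\<in>{1..H}. lam T h - \<nu> (T + 1) = 0) \<and>
    (\<forall>t\<in>{1..T + 1}. - (\<Sum>h=1..H. \<nu> t * a t h) = 0) \<and>
    (\<forall>h\<in>{1..H}. \<theta> h \<ge> 0) \<and>
    (\<forall>t\<in>{1..T + 1}. \<nu> t \<ge> 0)"

lemma pareto_imp_kkt:
  assumes pareto: "pareto_optimal H U (objective T \<beta> u) (c, a)"
  shows "\<exists>\<theta> lam \<nu>. kkt \<theta> lam \<nu>"
proof -
  have 1: "(1::nat) \<in> {1..H}" using H_pos by simp
  \<comment> \<open>The weights normalise \<open>lam T h\<close> to 1. Then (I) holds by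
    construction, (III) forces \<open>\<nu> (T + 1) = 1\<close>, and (II) for household 1 is solved
    for the remaining \<open>\<nu> t\<close>.\<close>
  define \<theta> where "\<theta> = (\<lambda>h. \<tau> / p T h)"
  define lam where "lam = (\<lambda>t h. p t h / p T h)"
  define \<nu> where "\<nu> = (\<lambda>t. if t = T + 1 then 1 else lam (t - 1) 1 - lam t 1 * q t)"
  have lam_eq: "lam t h = lam t 1" if "t \<le> T" "h \<in> {1..H}" for t h
    using marginal_rates_le[OF pareto that(2) 1 that(1)] marginal_rates_le[OF pareto 1 that(2,1)]
    by (simp add: lam_def)
  have p_T: "p T h > 0" if "h \<in> {1..H}" for h
    using p_pos that by simp
  have \<nu>_Suc: "\<nu> (Suc t) = (p t 1 - q (Suc t) * p (Suc t) 1) / p T 1" if "Suc t \<le> T" for t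
    using that by (simp add: \<nu>_def lam_def diff_divide_distrib mult.commute)
  \<comment> \<open>Saving one unit (\<open>m = 1\<close>) does not pay.\<close>
  have \<nu>_nonneg: "\<nu> t \<ge> 0" if "t \<in> {1..T + 1}" for t
  proof (cases "t = T + 1")
    case False
    with that obtain s where "t = Suc s" "Suc s \<le> T" by (cases t) auto
    then show ?thesis
      using no_gain_from_saving[OF pareto 1, of s 1] p_T[OF 1] by (simp add: \<nu>_Suc)
  qed (simp add: \<nu>_def)
  \<comment> \<open>Where aggregate assets are positive, dissaving (\<open>m = - 1\<close>) does not
    pay either, so \<open>\<nu> t\<close> vanishes.\<close>
  have compl: "\<nu> t * (\<Sum>h=1..H. a t h) = 0" if t: "t \<in> {1..T + 1}" for t
  proof (cases "t = T + 1")
    case True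
    then show ?thesis using final_assets_eq_0[OF pareto] by simp
  next
    case False
    with t obtain s where s: "t = Suc s" "Suc s \<le> T" by (cases t) auto
    show ?thesis
    proof (cases "(\<Sum>h=1..H. a t h) > 0")
      case True
      then have "p s 1 - q (Suc s) * p (Suc s) 1 \<le> 0"
        using no_gain_from_saving[OF pareto 1, of s "- 1"] s by simp
      then have "\<nu> t \<le> 0" using p_T[OF 1] s by (simp add: \<nu>_Suc divide_nonpos_pos)
      with \<nu>_nonneg[OF t] show ?thesis by simp
    next
      case False
      moreover have "(\<Sum>h=1..H. a t h) \<ge> 0"
        using feasible t by (auto simp: feasible_set_def)
      ultimately show ?thesis by simp
    qed
  qed
  have "kkt \<theta> lam \<nu>"
    unfolding kkt_def
  proof (intro conjI ballI)
    show "\<exists>h\<in>{1..H}. \<theta> h \<noteq> 0"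
      using 1 p_T[OF 1] \<tau>_pos by (intro bexI[of _ 1]) (auto simp: \<theta>_def)
    show "- \<theta> h * \<beta> h ^ t * deriv (u h) (c t h) + \<tau> * lam t h = 0" for t h
      by (simp add: \<theta>_def lam_def p_def)
    show "- \<nu> t + lam (t - 1) h - lam t h * (\<tau> * (1 + r t) - \<delta>) = 0"
      if "t \<in> {1..T}" "h \<in> {1..H}" for t h
    proof -
      have "t - 1 \<le> T" using that by auto
      then show ?thesis
        using that lam_eq[of t h] lam_eq[of "t - 1" h] by (simp add: \<nu>_def flip: q_def)
    qed
    show "lam T h - \<nu> (T + 1) = 0" if "h \<in> {1..H}" for h
      using p_T[OF that] by (simp add: lam_def \<nu>_def)
    show "- (\<Sum>h=1..H. \<nu> t * a t h) = 0" if "t \<in> {1..T + 1}" for t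
      using compl[OF that] by (simp flip: sum_distrib_left)
    show "\<theta> h \<ge> 0" if "h \<in> {1..H}" for h
      using p_T[OF that] \<tau>_pos by (simp add: \<theta>_def)
  qed (use \<nu>_nonneg in auto)
  then show ?thesis by blast
qed

section \<open>Sufficiency of the multiplier conditions\<close>

text \<open>A Pareto improvement would make the \<open>\<theta>\<close>-weighted utility gain
  positive, while tangents and the multipliers bound it by 0.\<close>

lemma kkt_imp_pareto:
  assumes kkt: "kkt \<theta> lam \<nu>"
  shows "pareto_optimal H U (objective T \<beta> u) (c, a)"
proof -
  have I: "\<theta> h * p t h = \<tau> * lam t h" if "t \<le> T" "h \<in> {1..H}" for t h
    using kkt that unfolding kkt_def p_def by (force simp: algebra_simps)
  have II_all: "\<forall>t\<in>{1..T}. \<forall>h\<in>{1..H}.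
      - \<nu> t + lam (t - 1) h - lam t h * (\<tau> * (1 + r t) - \<delta>) = 0"
    using kkt unfolding kkt_def by blast
  have II: "lam t h = \<nu> (Suc t) + lam (Suc t) h * q (Suc t)" if "Suc t \<le> T" "h \<in> {1..H}" for t h
    using II_all[rule_format, of "Suc t" h] that by (simp add: q_def)
  have III: "lam T h = \<nu> (Suc T)" if "h \<in> {1..H}" for h
    using kkt that by (auto simp: kkt_def)
  have IV: "\<nu> t * (\<Sum>h=1..H. a t h) = 0" if "t \<in> {1..Suc T}" for t
    using kkt that by (auto simp: kkt_def sum_distrib_left)
  have V: "\<theta> h \<ge> 0" "\<nu> t \<ge> 0" if "h \<in> {1..H}" "t \<in> {1..Suc T}" for h t
    using kkt that by (auto simp: kkt_def)
  define L where "L t = lam t 1" for t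
  have 1: "(1::nat) \<in> {1..H}" using H_pos by simp
  \<comment> \<open>Downward induction: (III) settles period \<open>T\<close>, and (II) computes
    period \<open>s\<close> from \<open>Suc s\<close>.\<close>
  have lam_L: "lam t h = L t" if "t \<le> T" "h \<in> {1..H}" for t h
    using that(1)
  proof (induction t rule: inc_induct)
    case base
    show ?case using III 1 that(2) by (simp add: L_def)
  next
    case (step s)
    then show ?case using II[of s h] II[of s 1] 1 that(2) by (simp add: L_def)
  qed
  \<comment> \<open>One nonzero weight gives \<open>\<tau> * L T > 0\<close> by (I) in period
    \<open>T\<close>; the same equation then makes every weight positive.\<close>
  obtain g where g: "g \<in> {1..H}" "\<theta> g \<noteq> 0"
    using kkt by (auto simp: kkt_def)
  with V(1)[of g 1] have "\<theta> g > 0" by auto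
  then have "\<tau> * L T > 0"
    using I[of T g] lam_L[of T g] p_pos[of T g] g by (metis le_refl mult_pos_pos)
  then have \<theta>_pos: "\<theta> h > 0" if "h \<in> {1..H}" for h
    using I[of T h] lam_L[of T h] p_pos[of T h] that by (metis le_refl zero_less_mult_pos2)
  have "False" if z: "(c', a') \<in> U"
    and le: "\<forall>h\<in>{1..H}. objective T \<beta> u h (c', a') \<le> objective T \<beta> u h (c, a)"
    and less: "\<exists>h\<in>{1..H}. objective T \<beta> u h (c', a') < objective T \<beta> u h (c, a)" for c' a'
  proof -
    define D where "D t = (\<Sum>h=1..H. assets a0 a' t h) - (\<Sum>h=1..H. assets a0 a t h)" for t
    have D0: "D 0 = 0" by (simp add: D_def assets_def)
    have D_Suc: "\<tau> * (\<Sum>h=1..H. c' t h - c t h) = q t * D t - D (Suc t)" if "t \<le> T" for t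
      using aggregate_assets[OF z that] aggregate_assets[OF feasible that]
      by (simp add: D_def sum_subtractf algebra_simps)
    \<comment> \<open>Summation by parts: by (II) the two coefficients of \<open>D t\<close> combine
      to \<open>- \<nu> t\<close>. The term at 0 drops because both plans start from
      \<open>a0\<close>.\<close>
    have parts: "(\<Sum>t=0..n. L t * (q t * D t - D (Suc t)))
        = - (\<Sum>t=1..n. \<nu> t * D t) - L n * D (Suc n)" if "n \<le> T" for n
      using that
    proof (induction n)
      case (Suc n)
      then have "L n = \<nu> (Suc n) + L (Suc n) * q (Suc n)"
        using II[of n 1] 1 by (simp add: L_def)
      then show ?case using Suc by (simp add: algebra_simps)
    qed (simp add: D0)
    \<comment> \<open>Complementary slackness (IV) removes the assets of the candidate plan.\<close>
    have \<nu>D: "\<nu> t * D t \<ge> 0" if "t \<in> {1..Suc T}" for t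
    proof -
      have "(\<Sum>h=1..H. a' t h) \<ge> 0" using z that by (auto simp: feasible_set_def)
      moreover have "\<nu> t * D t = \<nu> t * (\<Sum>h=1..H. a' t h)"
        using IV[OF that] that by (simp add: D_def assets_def right_diff_distrib)
      ultimately show ?thesis using V(2)[OF 1 that] by (metis mult_nonneg_nonneg)
    qed
    have "(\<Sum>h=1..H. \<theta> h * (objective T \<beta> u h (c, a) - objective T \<beta> u h (c', a')))
        \<le> (\<Sum>h=1..H. \<theta> h * (\<Sum>t=0..T. p t h * (c' t h - c t h)))"
    proof (intro sum_mono mult_left_mono)
      fix h assume h: "h \<in> {1..H}"
      have "\<beta> h ^ t * u h (c' t h) - \<beta> h ^ t * u h (c t h) \<le> p t h * (c' t h - c t h)"
        if "t \<in> {0..T}" for t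
      proof -
        have "c' t h > 0" using z h that by (auto simp: feasible_set_def)
        then have "u h (c' t h) - u h (c t h) \<le> deriv (u h) (c t h) * (c' t h - c t h)"
          using inada_utility_le_tangent[OF utility[OF h] c_pos[of t h]] h that by force
        then have "\<beta> h ^ t * (u h (c' t h) - u h (c t h))
            \<le> \<beta> h ^ t * (deriv (u h) (c t h) * (c' t h - c t h))"
          using \<beta>_pos[OF h] by (intro mult_left_mono) auto
        then show ?thesis by (simp add: p_def algebra_simps)
      qed
      then show "objective T \<beta> u h (c, a) - objective T \<beta> u h (c', a')
          \<le> (\<Sum>t=0..T. p t h * (c' t h - c t h))"
        by (auto simp: objective_def simp flip: sum_subtractf intro!: sum_mono)
      show "\<theta> h \<ge> 0" using \<theta>_pos[OF h] by simp
    qed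
    also have "\<dots> = (\<Sum>h=1..H. \<Sum>t=0..T. \<tau> * L t * (c' t h - c t h))"
      unfolding sum_distrib_left
      by (intro sum.cong refl) (use I lam_L in \<open>simp flip: mult.assoc\<close>)
    also have "\<dots> = (\<Sum>t=0..T. \<Sum>h=1..H. \<tau> * L t * (c' t h - c t h))"
      by (rule sum.swap)
    also have "\<dots> = (\<Sum>t=0..T. L t * (\<tau> * (\<Sum>h=1..H. c' t h - c t h)))"
      by (simp only: sum_distrib_left mult_ac)
    also have "\<dots> = (\<Sum>t=0..T. L t * (q t * D t - D (Suc t)))"
      by (intro sum.cong) (use D_Suc in auto)
    \<comment> \<open>By (III) the boundary term \<open>L T * D (Suc T)\<close> is the summand for
      \<open>t = Suc T\<close>.\<close>
    also have "\<dots> = - (\<Sum>t=1..Suc T. \<nu> t * D t)"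
      using parts[of T] III[OF 1] by (simp add: L_def)
    also have "\<dots> \<le> 0"
      using \<nu>D by (simp only: neg_le_0_iff_le) (rule sum_nonneg)
    finally have "(\<Sum>h=1..H. \<theta> h * (objective T \<beta> u h (c, a) - objective T \<beta> u h (c', a'))) \<le> 0" .
    moreover have "(\<Sum>h=1..H. \<theta> h * (objective T \<beta> u h (c, a) - objective T \<beta> u h (c', a'))) > 0"
    proof -
      obtain k where "k \<in> {1..H}" "objective T \<beta> u k (c', a') < objective T \<beta> u k (c, a)"
        using less by blast
      with \<theta>_pos le show ?thesis
        by (intro sum_pos2[of _ k]) (auto intro!: mult_nonneg_nonneg less_imp_le[OF \<theta>_pos])
    qed
    ultimately show False by simp
  qed
  then show ?thesis
    using feasible by (auto simp: pareto_optimal_def)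
qed

end

theorem theorem2:
  fixes H T :: nat
    and r \<omega> l \<beta> a0 :: "nat \<Rightarrow> real"
    and \<tau> \<delta> :: real
    and u :: "nat \<Rightarrow> real \<Rightarrow> real"
    and cbar abar :: "nat \<Rightarrow> nat \<Rightarrow> real"
  assumes "H > 0" and "T > 0"
    and "\<forall>t\<in>{0..T}. r t > 0"
    and "\<forall>t\<in>{0..T}. \<omega> t \<ge> 1"
    and "\<forall>h\<in>{1..H}. l h > 0"
    and "\<forall>h\<in>{1..H}. 0 < \<beta> h \<and> \<beta> h < 1"
    and "\<tau> \<ge> 1"
    and "0 < \<delta>" and "\<delta> < 1"
    and "(\<Sum>h=1..H. a0 h) > 0"
    and "\<forall>h\<in>{1..H}. inada_utility (u h)"
    and "(cbar, abar) \<in> feasible_set H T r \<omega> l \<tau> \<delta> a0"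
  shows "pareto_optimal H (feasible_set H T r \<omega> l \<tau> \<delta> a0) (objective T \<beta> u) (cbar, abar) \<longleftrightarrow>
    (\<exists>(\<theta> :: nat \<Rightarrow> real) (lam :: nat \<Rightarrow> nat \<Rightarrow> real) (\<nu> :: nat \<Rightarrow> real).
      (\<exists>h\<in>{1..H}. \<theta> h \<noteq> 0) \<and>
      (\<forall>t\<in>{0..T}. \<forall>h\<in>{1..H}. - \<theta> h * \<beta> h ^ t * deriv (u h) (cbar t h) + \<tau> * lam t h = 0) \<and>
      (\<forall>t\<in>{1..T}. \<forall>h\<in>{1..H}.
         - \<nu> t + lam (t - 1) h - lam t h * (\<tau> * (1 + r t) - \<delta>) = 0) \<and>
      (\<forall>h\<in>{1..H}. lam T h - \<nu> (T + 1) = 0) \<and>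
      (\<forall>t\<in>{1..T + 1}. - (\<Sum>h=1..H. \<nu> t * abar t h) = 0) \<and>
      (\<forall>h\<in>{1..H}. \<theta> h \<ge> 0) \<and>
      (\<forall>t\<in>{1..T + 1}. \<nu> t \<ge> 0))"
proof -
  interpret economy H T r \<omega> l \<beta> a0 \<tau> \<delta> u cbar abar
    by unfold_locales (use assms in auto)
  show ?thesis
    using pareto_imp_kkt kkt_imp_pareto unfolding kkt_def by blast
qed

end
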